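(* Let $a,b,c,d\in\mathbb{Z}$ with $a\neq 0$ and $c\neq 0$, and let $f(x)=ax+b$ and $g(x)=cx+d$. Then $$\liminf_{N\to\infty}\frac{1}{2N+1}\Big|\{x\in\mathbb{Z} : -N\le x\le N,\ \gcd(f(x),g(x))=1\}\Big|>0$$ if and only if $\gcd(a,b,c,d)=1$ and $ad\neq bc$.
   Context: $\gcd(a_1,\ldots,a_n)$ denotes the (nonnegative) greatest common divisor of the integers $a_1,\ldots,a_n$. *)

theory Defs
  imports Complex_Main "HOL-Library.Extended_Real"
begin

end

theory Submission
  imports Defs "HOL-Computational_Algebra.Primes"
begin

text \<open>
  Since a (c x + d) - c (a x + b) = a d - b c =: D, the gcd of the two values divides D, so for
  D \<noteq> 0 the set of x with coprime values is a union of residue classes modulo D, and has positive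
  lower density as soon as it is nonempty. If gcd(a, b, c, d) = 1, a member is
  the product of those primes dividing D that do not divide gcd(b, d): a prime dividing both values
  must divide D, and it divides x exactly when it does not divide gcd(b, d).
  If D = 0, coprimality forces a x + b to divide a, which leaves only finitely many x.
\<close>

text \<open>The count never exceeds \<open>card S\<close>, while the normalising factor tends to 0,
  so the ratio is squeezed to 0.\<close>

lemma liminf_density_eq_0_if_finite:
  fixes S :: "int set"
  assumes "finite S"
  shows "liminf (\<lambda>N. ereal (1 / (2 * real N + 1) *
           real (card {x. - int N \<le> x \<and> x \<le> int N \<and> x \<in> S}))) = 0"
proof (rule lim_imp_Liminf)
  have *: "(\<lambda>N. 1 / (2 * real N + 1)) \<longlonglongrightarrow> 0"
    by (rule tendsto_divide_0[OF tendsto_const])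
       (intro filterlim_at_top_imp_at_infinity filterlim_at_top_mono[OF filterlim_real_sequentially]
          always_eventually allI, simp)
  have "(\<lambda>N. 1 / (2 * real N + 1) * real (card {x. - int N \<le> x \<and> x \<le> int N \<and> x \<in> S})) \<longlonglongrightarrow> 0"
  proof (rule tendsto_sandwich[OF _ _ tendsto_const])
    show "(\<lambda>N. 1 / (2 * real N + 1) * real (card S)) \<longlonglongrightarrow> 0"
      using tendsto_mult_left_zero[OF *] .
    have "card {x. - int N \<le> x \<and> x \<le> int N \<and> x \<in> S} \<le> card S" for N
      by (rule card_mono[OF assms]) auto
    then show "\<forall>\<^sub>F N in sequentially.
        1 / (2 * real N + 1) * real (card {x. - int N \<le> x \<and> x \<le> int N \<and> x \<in> S})
          \<le> 1 / (2 * real N + 1) * real (card S)"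
      by (intro always_eventually allI mult_left_mono) auto
  qed (intro always_eventually allI, simp)
  then show "(\<lambda>N. ereal (1 / (2 * real N + 1) *
      real (card {x. - int N \<le> x \<and> x \<le> int N \<and> x \<in> S}))) \<longlonglongrightarrow> 0"
    by (simp add: zero_ereal_def)
qed simp

text \<open>The forward half of a progression suffices: for large \<open>N\<close> the window
  contains more than \<open>N / M\<close> of its terms, where \<open>M = m + \<bar>x0\<bar>\<close>,
  which keeps the density above \<open>1 / (2 * M)\<close>.\<close>

lemma liminf_density_pos_if_progression:
  fixes S :: "int set" and x0 m :: int
  assumes "m > 0" and prog: "\<And>k. x0 + int k * m \<in> S"
  shows "liminf (\<lambda>N. ereal (1 / (2 * real N + 1) *
           real (card {x. - int N \<le> x \<and> x \<le> int N \<and> x \<in> S}))) > 0"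
proof -
  \<comment> \<open>Adding \<open>\<bar>x0\<bar>\<close> to the step absorbs the offset:
    \<open>q * M \<le> N\<close> with \<open>q \<ge> 1\<close> forces
    \<open>q * m + \<bar>x0\<bar> \<le> N\<close>, so the terms with index \<open>0\<close> to
    \<open>q\<close> all lie in the window.\<close>
  define M where "M = nat (m + \<bar>x0\<bar>)"
  have M: "int M = m + \<bar>x0\<bar>" "M > 0"
    using assms(1) by (auto simp: M_def)
  have bound: "1 / (2 * real M) \<le> 1 / (2 * real N + 1) *
      real (card {x. - int N \<le> x \<and> x \<le> int N \<and> x \<in> S})" if "N \<ge> M" for N
  proof -
    define q where "q = N div M"
    have q1: "q \<ge> 1"
      using that M(2) by (simp add: q_def Suc_le_eq div_greater_zero_iff)
    have "q * M \<le> N" by (simp add: q_def)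
    then have "int q * int M \<le> int N" by (metis of_nat_le_iff of_nat_mult)
    then have qN: "int q * m + int q * \<bar>x0\<bar> \<le> int N" by (simp add: M distrib_left)
    have "1 * \<bar>x0\<bar> \<le> int q * \<bar>x0\<bar>" using q1 by (intro mult_right_mono) auto
    with qN have qN': "int q * m + \<bar>x0\<bar> \<le> int N" by simp
    have "(\<lambda>k. x0 + int k * m) ` {..q} \<subseteq> {x. - int N \<le> x \<and> x \<le> int N \<and> x \<in> S}"
    proof safe
      fix k assume "k \<le> q"
      then have "int k * m \<le> int q * m" using assms(1) by (intro mult_right_mono) auto
      moreover have "0 \<le> int k * m" using assms(1) by simp
      ultimately show "- int N \<le> x0 + int k * m" "x0 + int k * m \<le> int N"
        using qN' by linarith+
    qed (rule prog)
    moreover have "finite {x. - int N \<le> x \<and> x \<le> int N \<and> x \<in> S}"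
      by (rule finite_subset[of _ "{- int N..int N}"]) auto
    ultimately have "card ((\<lambda>k. x0 + int k * m) ` {..q})
        \<le> card {x. - int N \<le> x \<and> x \<le> int N \<and> x \<in> S}"
      by (rule card_mono[rotated])
    moreover have "inj_on (\<lambda>k. x0 + int k * m) {..q}"
      using assms(1) by (auto simp: inj_on_def)
    ultimately have card: "q + 1 \<le> card {x. - int N \<le> x \<and> x \<le> int N \<and> x \<in> S}"
      by (simp add: card_image)
    \<comment> \<open>The strict inequality between naturals gives
      \<open>2 * N + 2 \<le> (q + 1) * (2 * M)\<close>, which covers the window length
      \<open>2 * N + 1\<close>.\<close>
    have "N < (q + 1) * M"
      using M(2) by (simp add: q_def dividend_less_div_times add.commute)
    then have "2 * N + 1 \<le> (q + 1) * (2 * M)" by simp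
    also have "\<dots> \<le> card {x. - int N \<le> x \<and> x \<le> int N \<and> x \<in> S} * (2 * M)"
      using card by (rule mult_right_mono) simp
    finally have "real (2 * N + 1)
        \<le> real (card {x. - int N \<le> x \<and> x \<le> int N \<and> x \<in> S} * (2 * M))"
      by (rule of_nat_mono)
    then show ?thesis
      using M(2) by (simp add: field_simps)
  qed
  have "0 < ereal (1 / (2 * real M))" using M(2) by simp
  also have "\<dots> \<le> liminf (\<lambda>N. ereal (1 / (2 * real N + 1) *
           real (card {x. - int N \<le> x \<and> x \<le> int N \<and> x \<in> S})))"
    by (rule Liminf_bounded)
       (use bound in \<open>auto simp: eventually_sequentially simp del: times_divide_eq_left\<close>)
  finally show ?thesis .
qed

lemma dvd_determinant:
  fixes a b c d x p :: int
  assumes "p dvd a * x + b" and "p dvd c * x + d"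
  shows "p dvd a * d - b * c"
proof -
  have "p dvd a * (c * x + d) - c * (a * x + b)"
    using assms by (intro dvd_diff dvd_mult)
  then show ?thesis by (simp add: algebra_simps)
qed

lemma ex_coprime_linear_values:
  fixes a b c d :: int
  assumes "Gcd {a, b, c, d} = 1" and "a * d \<noteq> b * c"
  shows "\<exists>x. gcd (a * x + b) (c * x + d) = 1"
proof -
  define P where "P = {p. prime p \<and> p dvd a * d - b * c \<and> \<not> p dvd gcd b d}"
  define x where "x = \<Prod>P"
  \<comment> \<open>A nonzero determinant has only finitely many divisors, so the product over
    \<open>P\<close> is a genuine one.\<close>
  have "finite P"
    by (rule finite_subset[of _ "{p. p dvd a * d - b * c}"])
       (use assms(2) in \<open>auto simp: P_def\<close>)
  then have dvd_x: "p dvd x \<longleftrightarrow> p \<in> P" if "prime p" for p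
    using that by (auto simp: x_def prime_dvd_prod_iff P_def dest: primes_dvd_imp_eq)
  have "gcd (a * x + b) (c * x + d) = 1"
  proof (rule ccontr)
    assume "gcd (a * x + b) (c * x + d) \<noteq> 1"
    then have "\<bar>gcd (a * x + b) (c * x + d)\<bar> \<noteq> 1" by simp
    then obtain p where "prime p" "p dvd gcd (a * x + b) (c * x + d)"
      by (rule prime_factor_int)
    then have p: "prime p" "p dvd a * x + b" "p dvd c * x + d" by simp_all
    then have D: "p dvd a * d - b * c" by (intro dvd_determinant)
    show False
    \<comment> \<open>If \<open>p\<close> divides \<open>b\<close> and \<open>d\<close>, it divides
      \<open>a * x\<close> and \<open>c * x\<close> but not \<open>x\<close>, hence all four
      coefficients. Otherwise \<open>p\<close> divides \<open>x\<close>, and subtracting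
      \<open>a * x\<close> and \<open>c * x\<close> from the values makes it divide \<open>b\<close>
      and \<open>d\<close> after all.\<close>
    proof (cases "p dvd gcd b d")
      case True
      then have "\<not> p dvd x" using dvd_x p by (simp add: P_def)
      moreover have "p dvd a * x" "p dvd c * x"
        using True p by (simp_all add: dvd_add_left_iff)
      ultimately have "p dvd a" "p dvd c"
        using p(1) by (auto simp: prime_dvd_mult_iff)
      with True have "p dvd Gcd {a, b, c, d}" by simp
      with assms(1) p(1) show False by (simp add: not_prime_unit)
    next
      case False
      then have "p dvd x" using dvd_x p D by (simp add: P_def)
      with p False show False by (simp add: dvd_add_right_iff)
    qed
  qed
  then show ?thesis ..
qed

text \<open>The gcd at the shifted point divides the determinant. The shift changes both values by
  multiples of the determinant, so this gcd also divides the two original, coprime values.\<close>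

lemma gcd_linear_values_shift:
  fixes a b c d x k :: int
  assumes "gcd (a * x + b) (c * x + d) = 1"
  shows "gcd (a * (x + k * (a * d - b * c)) + b) (c * (x + k * (a * d - b * c)) + d) = 1"
proof -
  define y where "y = x + k * (a * d - b * c)"
  define h where "h = gcd (a * y + b) (c * y + d)"
  have D: "h dvd a * d - b * c"
    by (rule dvd_determinant[of _ _ y]) (simp_all add: h_def)
  have "h dvd (a * y + b) - a * k * (a * d - b * c)" "h dvd (c * y + d) - c * k * (a * d - b * c)"
    by (intro dvd_diff dvd_mult D; simp add: h_def)+
  then have "h dvd a * x + b" "h dvd c * x + d"
    by (simp_all add: y_def algebra_simps)
  then have "h dvd 1" using assms by (metis gcd_greatest)
  then show ?thesis by (simp add: h_def y_def)
qed

lemma finite_coprime_linear_values: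
  fixes a b c d :: int
  assumes "a \<noteq> 0" and "a * d = b * c"
  shows "finite {x. gcd (a * x + b) (c * x + d) = 1}"
proof (rule finite_subset)
  show "{x. gcd (a * x + b) (c * x + d) = 1} \<subseteq> {- (\<bar>a\<bar> + \<bar>b\<bar>)..\<bar>a\<bar> + \<bar>b\<bar>}"
  proof (intro subsetI)
    fix x assume "x \<in> {x. gcd (a * x + b) (c * x + d) = 1}"
    then have "coprime (a * x + b) (c * x + d)" by (simp add: coprime_iff_gcd_eq_1)
    \<comment> \<open>With zero determinant the two linear forms are proportional, so
      \<open>a * x + b\<close> divides \<open>a\<close> times a number coprime to it.\<close>
    moreover have "a * (c * x + d) = (a * x + b) * c"
      using assms(2) by (simp add: algebra_simps)
    then have "a * x + b dvd a * (c * x + d)" by simp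
    ultimately have "a * x + b dvd a" by (simp add: coprime_dvd_mult_left_iff)
    then have "\<bar>a * x + b\<bar> \<le> \<bar>a\<bar>" using assms(1) by (simp add: dvd_imp_le_int)
    \<comment> \<open>Since \<open>\<bar>a\<bar> \<ge> 1\<close>, a bound on \<open>a * x\<close> is
      also a bound on \<open>x\<close>.\<close>
    moreover have "1 * \<bar>x\<bar> \<le> \<bar>a\<bar> * \<bar>x\<bar>" using assms(1) by (intro mult_right_mono) auto
    ultimately have "\<bar>x\<bar> \<le> \<bar>a\<bar> + \<bar>b\<bar>" by (simp flip: abs_mult)
    then show "x \<in> {- (\<bar>a\<bar> + \<bar>b\<bar>)..\<bar>a\<bar> + \<bar>b\<bar>}" by auto
  qed
qed simp

theorem theorem1p1:
  fixes a b c d :: int and f g :: "int \<Rightarrow> int"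
  assumes "a \<noteq> 0" and "c \<noteq> 0"
    and "f = (\<lambda>x. a * x + b)" and "g = (\<lambda>x. c * x + d)"
  shows "liminf (\<lambda>N::nat. ereal (1 / (2 * real N + 1) *
             real (card {x::int. - int N \<le> x \<and> x \<le> int N \<and> gcd (f x) (g x) = 1}))) > 0
         \<longleftrightarrow> Gcd {a, b, c, d} = 1 \<and> a * d \<noteq> b * c"
proof -
  define S where "S = {x. gcd (f x) (g x) = 1}"
  have "liminf (\<lambda>N. ereal (1 / (2 * real N + 1) *
      real (card {x. - int N \<le> x \<and> x \<le> int N \<and> x \<in> S}))) > 0
      \<longleftrightarrow> Gcd {a, b, c, d} = 1 \<and> a * d \<noteq> b * c" (is "?L > 0 \<longleftrightarrow> ?R")
  proof
    assume ?R
    then obtain x0 where "gcd (a * x0 + b) (c * x0 + d) = 1"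
      using ex_coprime_linear_values by metis
    then have shift: "x0 + k * (a * d - b * c) \<in> S" for k
      using gcd_linear_values_shift by (simp add: S_def assms(3,4))
    \<comment> \<open>The determinant may be negative, whereas the progression lemma wants a
      positive step; the factor \<open>sgn\<close> turns one into the other.\<close>
    have "x0 + int k * \<bar>a * d - b * c\<bar> \<in> S" for k
      using shift[of "int k * sgn (a * d - b * c)"] by (simp add: abs_sgn mult_ac)
    then show "?L > 0"
      using \<open>?R\<close> by (intro liminf_density_pos_if_progression) auto
  next
    assume L: "?L > 0"
    show ?R
    proof (rule ccontr)
      assume "\<not> ?R"
      then consider "a * d = b * c" | "Gcd {a, b, c, d} \<noteq> 1" by blast
      then have "finite S"
      proof cases
        case 1
        then show ?thesis
          using finite_coprime_linear_values assms(1) by (simp add: S_def assms(3,4))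
      next
        \<comment> \<open>A common divisor of the four coefficients divides both values at every
          \<open>x\<close>, so coprimality never occurs.\<close>
        case 2
        define h where "h = Gcd {a, b, c, d}"
        have "h dvd a" "h dvd b" "h dvd c" "h dvd d"
          unfolding h_def by (rule Gcd_dvd; simp)+
        then have "h dvd gcd (f x) (g x)" for x by (simp add: assms(3,4))
        moreover have "\<not> h dvd 1" using 2 by (simp add: h_def)
        ultimately have "S = {}" unfolding S_def by (metis (mono_tags, lifting) Collect_empty_eq)
        then show ?thesis by simp
      qed
      then show False using L liminf_density_eq_0_if_finite by simp
    qed
  qed
  then show ?thesis by (simp add: S_def)
qed

end
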